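(* For every $n\ge1$, the path on $n$ vertices is $123$-representable.
   Context: A word is a finite sequence of letters from a totally ordered alphabet. Two letters $x,y$ alternate in a word $w$ if between any two occurrences of $x$ there is an occurrence of $y$ and between any two occurrences of $y$ there is an occurrence of $x$. A graph $G=(V,E)$ is represented by a word $w$ over $V$ if for all distinct $x,y\in V$, $x$ and $y$ alternate in $w$ if and only if $xy\in E$. A word is $123$-avoiding if it has no strictly increasing subsequence of length $3$. A graph is $123$-representable if, after labeling its vertices by distinct elements of a totally ordered set (any labeling may be chosen), it is represented by a $123$-avoiding word. *)

theory Defs
  imports Main "HOL-Library.Sublist"
begin

text \<open>An undirected graph is a vertex set together with a set of two-element sets of vertices.
  Words are lists.\<close>

type_synonym 'a graph = "'a set \<times> 'a set set"

definition separates :: "'a \<Rightarrow> 'a \<Rightarrow> 'a list \<Rightarrow> bool" where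
  "separates y x w \<longleftrightarrow>
     (\<forall>i j. i < j \<and> j < length w \<and> w ! i = x \<and> w ! j = x \<longrightarrow>
        (\<exists>k. i < k \<and> k < j \<and> w ! k = y))"

definition alternate :: "'a \<Rightarrow> 'a \<Rightarrow> 'a list \<Rightarrow> bool" where
  "alternate x y w \<longleftrightarrow> separates y x w \<and> separates x y w"

text \<open>We use the usual convention that a word representing a graph contains every vertex at
  least once. For 123-representability this is no restriction: a vertex that does not occur may
  be given a label larger than all labels that do occur, and the absent vertices can then be put
  in front of the word in decreasing order of their labels.\<close>

definition represents :: "'a list \<Rightarrow> 'a graph \<Rightarrow> bool" where
  "represents w G \<longleftrightarrow> (case G of (V, E) \<Rightarrow>
     set w = V \<and> (\<forall>x\<in>V. \<forall>y\<in>V. x \<noteq> y \<longrightarrow> (alternate x y w \<longleftrightarrow> {x, y} \<in> E)))"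

definition avoids_123 :: "'a::linorder list \<Rightarrow> bool" where
  "avoids_123 w \<longleftrightarrow> \<not> (\<exists>s. subseq s w \<and> length s = 3 \<and> sorted_wrt (<) s)"

definition relabel :: "('a \<Rightarrow> 'b) \<Rightarrow> 'a graph \<Rightarrow> 'b graph" where
  "relabel f G = (case G of (V, E) \<Rightarrow> (f ` V, (`) f ` E))"

text \<open>Labels are natural numbers: a represented graph is finite, and every finite totally ordered
  set embeds into the naturals.\<close>

definition representable_123 :: "'a graph \<Rightarrow> bool" where
  "representable_123 G \<longleftrightarrow>
     (\<exists>(f :: 'a \<Rightarrow> nat) w. inj_on f (fst G) \<and> avoids_123 w \<and> represents w (relabel f G))"

definition path_graph :: "nat \<Rightarrow> nat graph" where
  "path_graph n = ({1..n}, {{i, i + 1} | i. 1 \<le> i \<and> i < n})"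

end

theory Submission
  imports Defs
begin

text \<open>The word \<open>1, 2 1, 3 2, \<dots>, n (n - 1), n\<close> represents the path: the occurrences of a vertex
  interleave exactly with those of its two neighbours. Its only descents go from a letter \<open>i + 1\<close>
  opening a pair to one closing a pair, so there is no decreasing subsequence of length 3; reversing
  the order of the labels turns this into 123-avoidance.\<close>

text \<open>Away from the ends, a letter \<open>x\<close> opens at the odd position
  \<open>2 * x - 3\<close> and closes at the even position \<open>2 * x\<close>. The
  \<open>max\<close> makes position \<open>0\<close> open \<open>1\<close>, and the
  \<open>min\<close> makes the last position close \<open>n\<close>.\<close>

definition path_letter :: "nat \<Rightarrow> nat \<Rightarrow> nat" where
  "path_letter n k = (if even k then max 1 (k div 2) else min (k div 2 + 2) n)"

definition path_word :: "nat \<Rightarrow> nat list" where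
  "path_word n = map (path_letter n) [0..<2 * n]"

text \<open>The avoidance argument uses the parity of positions, so a subsequence has to be traded
  for indices.\<close>

lemma subseq_three_nth:
  assumes "subseq [a, b, c] w"
  obtains i j k where "i < j" "j < k" "k < length w" "w ! i = a" "w ! j = b" "w ! k = c"
proof -
  obtain us vs where w: "w = us @ a # vs" and bc: "subseq [b, c] vs"
    using list_emb_ConsD[OF assms] by blast
  obtain us' vs' where vs: "vs = us' @ b # vs'" and c: "subseq [c] vs'"
    using list_emb_ConsD[OF bc] by blast
  obtain us'' vs'' where vs': "vs' = us'' @ c # vs''"
    using list_emb_ConsD[OF c] by blast
  show thesis
    by (rule that[of "length us" "length us + 1 + length us'"
          "length us + 1 + length us' + 1 + length us''"])
      (auto simp: w vs vs' nth_append)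
qed

lemma separates_map:
  assumes "inj_on f V" "set w \<subseteq> V" "x \<in> V" "y \<in> V"
  shows "separates (f y) (f x) (map f w) \<longleftrightarrow> separates y x w"
proof -
  have nth: "map f w ! i = f z \<longleftrightarrow> w ! i = z" if "i < length w" "z \<in> V" for i z
    using assms(1,2) that by (auto simp: inj_on_def subset_iff)
  have "(map f w ! i = f x \<and> map f w ! j = f x \<longrightarrow> (\<exists>k. i < k \<and> k < j \<and> map f w ! k = f y)) \<longleftrightarrow>
      (w ! i = x \<and> w ! j = x \<longrightarrow> (\<exists>k. i < k \<and> k < j \<and> w ! k = y))"
    if "i < j" "j < length w" for i j
  proof -
    have "map f w ! k = f y \<longleftrightarrow> w ! k = y" if "k < j" for k
      using nth that \<open>j < length w\<close> assms(4) by simp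
    then show ?thesis using that nth assms(3) by auto
  qed
  then show ?thesis
    unfolding separates_def length_map by blast
qed

text \<open>With only two occurrences, \<open>a\<close> and \<open>b\<close> form the single pair of
  positions to be examined.\<close>

lemma separates_iff_between:
  assumes occ: "\<And>k. k < length w \<Longrightarrow> w ! k = x \<longleftrightarrow> k = a \<or> k = b" and "a < b" "b < length w"
  shows "separates y x w \<longleftrightarrow> (\<exists>k. a < k \<and> k < b \<and> w ! k = y)"
proof
  show "separates y x w \<Longrightarrow> \<exists>k. a < k \<and> k < b \<and> w ! k = y"
    using assms by (simp add: separates_def)
  assume between: "\<exists>k. a < k \<and> k < b \<and> w ! k = y"
  show "separates y x w"
    unfolding separates_def
  proof (intro allI impI)
    fix i j assume ij: "i < j \<and> j < length w \<and> w ! i = x \<and> w ! j = x"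
    then have "i = a \<or> i = b" "j = a \<or> j = b"
      using occ[of i] occ[of j] by auto
    with ij \<open>a < b\<close> have "i = a" "j = b" by auto
    then show "\<exists>k. i < k \<and> k < j \<and> w ! k = y" using between by simp
  qed
qed

lemma represents_relabel:
  assumes inj: "inj_on f V" and rep: "represents w (V, E)" and E: "\<Union>E \<subseteq> V"
  shows "represents (map f w) (relabel f (V, E))"
proof -
  have w: "set w = V"
    and alt: "\<And>x y. x \<in> V \<Longrightarrow> y \<in> V \<Longrightarrow> x \<noteq> y \<Longrightarrow> alternate x y w \<longleftrightarrow> {x, y} \<in> E"
    using rep by (auto simp: represents_def)
  have edge: "{f x, f y} \<in> (`) f ` E \<longleftrightarrow> {x, y} \<in> E" if "x \<in> V" "y \<in> V" for x y
  proof
    assume "{f x, f y} \<in> (`) f ` E"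
    then obtain e where e: "e \<in> E" "f ` e = f ` {x, y}" by auto
    \<comment> \<open>Injectivity on \<open>V\<close> recovers an edge from its image because every
      edge lies inside \<open>V\<close>.\<close>
    then have "e = {x, y}"
      using inj_on_image_eq_iff[OF inj, of e "{x, y}"] E that by blast
    with e show "{x, y} \<in> E" by simp
  next
    assume "{x, y} \<in> E"
    then have "f ` {x, y} \<in> (`) f ` E" by (rule imageI)
    then show "{f x, f y} \<in> (`) f ` E" by simp
  qed
  have "alternate (f x) (f y) (map f w) \<longleftrightarrow> alternate x y w" if "x \<in> V" "y \<in> V" for x y
    using that w by (simp add: alternate_def separates_map[OF inj])
  then show ?thesis
    using w alt edge by (auto simp: represents_def relabel_def)
qed

lemma length_path_word [simp]: "length (path_word n) = 2 * n"
  by (simp add: path_word_def)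

lemma path_word_nth [simp]: "k < 2 * n \<Longrightarrow> path_word n ! k = path_letter n k"
  by (simp add: path_word_def)

text \<open>The truncated subtraction puts the first occurrence of \<open>1\<close> at position \<open>0\<close>.\<close>

lemma path_letter_eq_iff:
  assumes "k < 2 * n" "1 \<le> x" "x \<le> n"
  shows "path_letter n k = x \<longleftrightarrow> k = 2 * x - 3 \<or> k = min (2 * x) (2 * n - 1)"
proof (cases "even k")
  case True
  then obtain m where "k = 2 * m" by blast
  \<comment> \<open>An untruncated \<open>2 * x - 3\<close> is odd. For \<open>x = 1\<close>
    truncation gives the even position \<open>0\<close>, hence the separate case below.\<close>
  moreover have "2 * m \<noteq> 2 * x - 3" if "2 \<le> x"
    using that by presburger
  moreover have "2 * m \<noteq> 2 * n - 1"
    using assms by presburger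
  ultimately show ?thesis
    using assms by (cases "x = 1") (auto simp: path_letter_def max_def min_def)
next
  case False
  then obtain m where "k = 2 * m + 1" by (blast elim: oddE)
  moreover from this have "k \<noteq> 2 * x"
    by presburger
  ultimately show ?thesis using assms by (auto simp: path_letter_def max_def min_def)
qed

lemma set_path_word: "set (path_word n) = {1..n}"
proof
  show "set (path_word n) \<subseteq> {1..n}"
    by (auto simp: path_word_def path_letter_def)
  show "{1..n} \<subseteq> set (path_word n)"
  proof
    fix x assume x: "x \<in> {1..n}"
    then have "path_letter n (2 * x - 3) = x" "2 * x - 3 < 2 * n"
      by (auto simp: path_letter_eq_iff)
    then show "x \<in> set (path_word n)"
      unfolding path_word_def by force
  qed
qed

text \<open>Between the two occurrences of \<open>x\<close> lie at most the positions
  \<open>2 * x - 2\<close> and \<open>2 * x - 1\<close>, holding \<open>x - 1\<close> and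
  \<open>x + 1\<close> where these vertices exist. The criterion is symmetric, so it settles both
  halves of \<open>alternate\<close>.\<close>

lemma separates_path_word:
  assumes "1 \<le> x" "x \<le> n" "1 \<le> y" "y \<le> n" "x \<noteq> y"
  shows "separates y x (path_word n) \<longleftrightarrow> y = x + 1 \<or> x = y + 1"
proof -
  have letter: "path_word n ! k = z \<longleftrightarrow> k = 2 * z - 3 \<or> k = min (2 * z) (2 * n - 1)"
    if "k < 2 * n" "1 \<le> z" "z \<le> n" for k z
    using that by (simp add: path_letter_eq_iff)
  have order: "2 * x - 3 < min (2 * x) (2 * n - 1)" and last: "min (2 * x) (2 * n - 1) < 2 * n"
    using assms by linarith+
  have "separates y x (path_word n) \<longleftrightarrow>
      (\<exists>k. 2 * x - 3 < k \<and> k < min (2 * x) (2 * n - 1) \<and> path_word n ! k = y)"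
    by (rule separates_iff_between) (use assms letter order last in simp_all)
  also have "\<dots> \<longleftrightarrow> (\<exists>k. 2 * x - 3 < k \<and> k < min (2 * x) (2 * n - 1) \<and>
      (k = 2 * y - 3 \<or> k = min (2 * y) (2 * n - 1)))"
    by (intro ex_cong1 conj_cong refl letter) (use last assms in auto)
  also have "\<dots> \<longleftrightarrow>
      (2 * x - 3 < 2 * y - 3 \<and> 2 * y - 3 < min (2 * x) (2 * n - 1)) \<or>
      (2 * x - 3 < min (2 * y) (2 * n - 1) \<and> min (2 * y) (2 * n - 1) < min (2 * x) (2 * n - 1))"
    by blast
  \<comment> \<open>The first disjunct, where \<open>y\<close> opens inside the pair of
    \<open>x\<close>, gives \<open>y = x + 1\<close>; the second, where \<open>y\<close> closes
    there, gives \<open>x = y + 1\<close>.\<close>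
  also have "\<dots> \<longleftrightarrow> y = x + 1 \<or> x = y + 1"
    using assms by linarith
  finally show ?thesis .
qed

lemma path_word_represents: "represents (path_word n) (path_graph n)"
  by (auto simp: represents_def path_graph_def set_path_word alternate_def
      separates_path_word doubleton_eq_iff)

text \<open>Letters increase weakly along the even positions and along the odd ones, and an odd
  position never holds a smaller letter than an earlier even one.\<close>

lemma path_letter_descent:
  assumes "p < q" "q < 2 * n" "path_letter n q < path_letter n p"
  shows "odd p \<and> even q"
  using assms by (auto simp: path_letter_def split: if_splits elim!: evenE oddE)

lemma avoids_123_path_word: "avoids_123 (map (\<lambda>v. n - v) (path_word n))"
  unfolding avoids_123_def
proof
  assume "\<exists>s. subseq s (map (\<lambda>v. n - v) (path_word n)) \<and> length s = 3 \<and> sorted_wrt (<) s"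
  then obtain x y z where "subseq [x, y, z] (map (\<lambda>v. n - v) (path_word n))" "x < y" "y < z"
    by (auto simp: numeral_3_eq_3 length_Suc_conv)
  then obtain i j k where ijk: "i < j" "j < k" "k < 2 * n"
    and "n - path_letter n i < n - path_letter n j" "n - path_letter n j < n - path_letter n k"
    by (elim subseq_three_nth) auto
  \<comment> \<open>A strict inequality between truncated differences still reverses.\<close>
  then have "path_letter n j < path_letter n i" "path_letter n k < path_letter n j"
    by auto
  \<comment> \<open>The middle position ends one descent and starts another.\<close>
  with ijk have "even j" "odd j"
    using path_letter_descent[of i j n] path_letter_descent[of j k n] by auto
  then show False by simp
qed

theorem theorem3p10:
  fixes n :: nat
  assumes "n \<ge> 1"
  shows "representable_123 (path_graph n)"
proof -
  \<comment> \<open>No truncation occurs up to \<open>n\<close>, so the order reversal is injective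
    on the vertices.\<close>
  have "inj_on (\<lambda>v. n - v) {1..n}"
    by (auto simp: inj_on_def)
  moreover from this have "represents (map (\<lambda>v. n - v) (path_word n)) (relabel (\<lambda>v. n - v) (path_graph n))"
    using path_word_represents[of n] unfolding path_graph_def
    by (rule represents_relabel) auto
  ultimately show ?thesis
    using avoids_123_path_word[of n] unfolding representable_123_def
    by (auto simp: path_graph_def)
qed

end
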